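(* Let $T_0>0$ be a real number and let an integer $p\ge2$ be given. If the family of functions $\mathcal G:=\{\widetilde F_i(x,\cdot):x\in\mathbf R^d,\ i=1,\dots,d\}$ satisfies $$\sum_{l_1,\dots,l_{2p}=0}^{N-1}\ \sup_{(g_1,\dots,g_{2p})\in\mathcal G^{2p}}\left|\mathbf E_\nu\left[\prod_{i=1}^{2p}g_i\circ T^{l_i}\right]\right|=O(N^p)\quad(N\to+\infty),$$ then $$\sup_{x\in\mathbf R^d}\left\|\sup_{t\in[0,T_0]}|e_t^\varepsilon(x,\cdot)|_\infty\right\|_{L^{2p}}=O(\sqrt\varepsilon)\quad(\varepsilon\to0).$$
   Context: $(\Omega,\mathcal F,\nu,T)$ is an invertible probability dynamical system: $(\Omega,\mathcal F,\nu)$ is a probability space, $T:\Omega\to\Omega$ is measurable and $\nu$-preserving, and $T$ is one-to-one from a set $\Omega\setminus N_0$ onto a set $\Omega\setminus N_1$ with $\nu(N_0)=\nu(N_1)=0$, with measurable inverse $T^{-1}$. $\mathbf E_\nu$ is the expectation and $L^{2p}$ the norm with respect to $\nu$. $d\ge1$ is an integer and $|\cdot|_\infty$ is the maximum norm on $\mathbf R^d$. $F:\mathbf R^d\times\Omega\to\mathbf R^d$ is measurable, uniformly bounded and uniformly Lipschitz continuous in the first parameter. $\bar F(x)=\int_\Omega F(x,\omega)\,d\nu(\omega)$, $\widetilde F(x,\omega)=F(x,\omega)-\bar F(x)$, with coordinates $\widetilde F_1,\dots,\widetilde F_d$. For $\varepsilon>0$ and $(x,\omega)\in\mathbf R^d\times\Omega$,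 $t\mapsto x_t^\varepsilon(x,\omega)$ ($t\ge0$) is the continuous solution of $\frac{dx_t^\varepsilon}{dt}(x,\omega)=F(x_t^\varepsilon(x,\omega),T^{\lfloor t/\varepsilon\rfloor}(\omega))$ for $t\notin\varepsilon\mathbf Z$, with $x_0^\varepsilon(x,\omega)=x$; $t\mapsto w_t(x)$ is the solution of $\frac{dw_t}{dt}(x)=\bar F(w_t(x))$, $w_0(x)=x$; and $e_t^\varepsilon(x,\omega)=x_t^\varepsilon(x,\omega)-w_t(x)$. *)

theory Defs
  imports "HOL-Probability.Probability"
begin

text \<open>
  Invertibility is only required modulo null sets. The sets \<open>N0\<close> and \<open>N1\<close> are null sets of
  \<open>M\<close>, and the inverse is measurable for the trace sigma-algebras.
\<close>

locale invertible_prob_system = prob_space M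
  for M :: "'a measure" and T :: "'a \<Rightarrow> 'a" +
  assumes T_measurable: "T \<in> measurable M M"
    and T_preserving: "distr M M T = M"
    and T_invertible: "\<exists>N0 \<in> null_sets M. \<exists>N1 \<in> null_sets M.
      bij_betw T (space M - N0) (space M - N1) \<and>
      the_inv_into (space M - N0) T
        \<in> measurable (restrict_space M (space M - N1)) (restrict_space M (space M - N0))"

definition averaged_field :: "'a measure \<Rightarrow> (real^'d \<Rightarrow> 'a \<Rightarrow> real^'d) \<Rightarrow> real^'d \<Rightarrow> real^'d" where
  "averaged_field M F x = (LINT \<omega>|M. F x \<omega>)"

definition centered_field ::
  "'a measure \<Rightarrow> (real^'d \<Rightarrow> 'a \<Rightarrow> real^'d) \<Rightarrow> real^'d \<Rightarrow> 'a \<Rightarrow> real^'d" where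
  "centered_field M F x \<omega> = F x \<omega> - averaged_field M F x"

definition centered_coordinates ::
  "'a measure \<Rightarrow> (real^'d \<Rightarrow> 'a \<Rightarrow> real^'d) \<Rightarrow> ('a \<Rightarrow> real) set" where
  "centered_coordinates M F = {(\<lambda>\<omega>. centered_field M F x \<omega> $ i) | x i. True}"

text \<open>
  The indices \<open>1, \<dots>, m\<close> are shifted to \<open>0, \<dots>, m - 1\<close>; a tuple is an extensional function
  on \<open>{..<m}\<close>.
\<close>

definition moment_sum ::
  "'a measure \<Rightarrow> ('a \<Rightarrow> 'a) \<Rightarrow> ('a \<Rightarrow> real) set \<Rightarrow> nat \<Rightarrow> nat \<Rightarrow> real" where
  "moment_sum M T G m N =
    (\<Sum>l \<in> {..<m} \<rightarrow>\<^sub>E {..<N}.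
      SUP g \<in> {..<m} \<rightarrow>\<^sub>E G. \<bar>LINT \<omega>|M. (\<Prod>i<m. g i ((T ^^ l i) \<omega>))\<bar>)"

definition perturbed_solution ::
  "('a \<Rightarrow> 'a) \<Rightarrow> (real^'d \<Rightarrow> 'a \<Rightarrow> real^'d) \<Rightarrow> real \<Rightarrow> real^'d \<Rightarrow> 'a \<Rightarrow> (real \<Rightarrow> real^'d) \<Rightarrow> bool" where
  "perturbed_solution T F \<epsilon> x \<omega> y \<longleftrightarrow>
    continuous_on {0..} y \<and> y 0 = x \<and>
    (\<forall>t\<ge>0. t \<notin> range (\<lambda>k::int. \<epsilon> * of_int k) \<longrightarrow>
      (y has_vector_derivative F (y t) ((T ^^ nat \<lfloor>t / \<epsilon>\<rfloor>) \<omega>)) (at t))"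

definition averaged_solution ::
  "'a measure \<Rightarrow> (real^'d \<Rightarrow> 'a \<Rightarrow> real^'d) \<Rightarrow> real^'d \<Rightarrow> (real \<Rightarrow> real^'d) \<Rightarrow> bool" where
  "averaged_solution M F x y \<longleftrightarrow>
    y 0 = x \<and>
    (\<forall>t\<ge>0. (y has_vector_derivative averaged_field M F (y t)) (at t within {0..}))"

text \<open>
  The \<open>L\<^sup>q\<close> norm takes values in \<^typ>\<open>ennreal\<close>, so that it is infinite, and not \<open>0\<close>, when
  the \<open>q\<close>-th moment is infinite. It is meant for \<open>q \<ge> 1\<close>.
\<close>

definition Lq_norm :: "nat \<Rightarrow> 'a measure \<Rightarrow> ('a \<Rightarrow> ennreal) \<Rightarrow> ennreal" where
  "Lq_norm q M f =
    (let I = (\<integral>\<^sup>+ \<omega>. f \<omega> ^ q \<partial>M) in if I = \<infinity> then \<infinity> else ennreal (root q (enn2real I)))"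

end

theory Submission
  imports Defs
begin

text \<open>
  Sample both trajectories at the times \<open>k \<epsilon>\<close>. Over one step the fast variable is frozen, so each
  trajectory follows an autonomous Lipschitz equation and differs from its Euler step by
  \<open>O(\<epsilon>\<^sup>2)\<close> (\<open>euler_step_error\<close>). Subtracting the two Euler steps, the error at time \<open>(k + 1) \<epsilon>\<close>
  is the error at time \<open>k \<epsilon>\<close>, plus a term at most \<open>\<epsilon> L\<close> times that error, plus
  \<open>\<epsilon>\<close> times the centered field at \<open>w(k \<epsilon>)\<close> and \<open>T\<^sup>k \<omega>\<close>, plus \<open>O(\<epsilon>\<^sup>2)\<close>. A discrete Gronwall
  argument then bounds the error up to time \<open>T0\<close> by a constant times \<open>\<epsilon>\<close> times one plus the
  largest partial sum of the centered fields (\<open>error_le_centered_sums\<close>). The centered field is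
  evaluated along the averaged trajectory, whose points do not depend on \<open>\<omega>\<close>; this is what
  makes the moment hypothesis applicable.

  Expanding the power \<open>2 p\<close> of such a partial sum with \<open>n\<close> terms and shifting time by invariance
  of the measure bounds its expectation by the moment sum, hence by \<open>K n\<^sup>p\<close>
  (\<open>moment_le_moment_sum\<close>). Since \<open>p > 1\<close>, a bound of this kind for all blocks passes, up to a
  constant, to the maximum over the partial sums (\<open>dyadic_maximal_inequality\<close>). With about
  \<open>T0 / \<epsilon>\<close> terms the \<open>L\<close>-norm of exponent \<open>2 p\<close> of the error is of order
  \<open>\<epsilon> sqrt (T0 / \<epsilon>) = sqrt (T0 \<epsilon>)\<close>. All constants depend only on the bound and the Lipschitz
  constant of the field, on \<open>K\<close>, \<open>T0\<close>, \<open>p\<close> and the dimension, which gives uniformity in the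
  starting point.
\<close>

section \<open>A maximal inequality for partial sums\<close>

text \<open>
  For \<open>c = root q 2 - 1\<close> one has \<open>(1 + c)\<^sup>q = 2\<close>; the constant is the factor by
  which \<open>(u + v)\<^sup>q\<close> can exceed \<open>u\<^sup>q\<close> when \<open>v \<le> u / c\<close>.
\<close>

definition doubling_constant :: "nat \<Rightarrow> real" where
  "doubling_constant q = (1 + 1 / (root q 2 - 1)) ^ q"

lemma doubling_constant_ge_1:
  assumes "0 < q"
  shows "1 \<le> doubling_constant q"
  unfolding doubling_constant_def using assms by (intro one_le_power) simp

text \<open>
  Any factor above 1 could stand before \<open>v ^ q\<close>, at the price of a larger constant before
  \<open>u ^ q\<close>. The factor 2 is chosen because the induction below needs 1 plus this factor to be
  strictly less than \<open>2 ^ p\<close>, and \<open>p \<ge> 2\<close>.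
\<close>

lemma power_add_le_twice_plus:
  fixes u v :: real
  assumes q: "0 < q" and u: "0 \<le> u" and v: "0 \<le> v"
  shows "(u + v) ^ q \<le> 2 * v ^ q + doubling_constant q * u ^ q"
proof -
  define c where "c = root q 2 - 1"
  have c: "c > 0" using q by (simp add: c_def)
  have c2: "(1 + c) ^ q = 2" using q by (simp add: c_def)
  have "(u + v) ^ q \<le> 2 * v ^ q + (1 + 1 / c) ^ q * u ^ q"
  proof (cases "u \<le> c * v")
    case True
    have "(u + v) ^ q \<le> ((1 + c) * v) ^ q"
      using True u v by (intro power_mono) (auto simp: algebra_simps)
    also have "\<dots> = 2 * v ^ q" by (simp add: power_mult_distrib c2)
    finally show ?thesis using u c by (simp add: add_increasing2)
  next
    case False
    then have "v \<le> u / c" using c by (simp add: field_simps)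
    then have "(u + v) ^ q \<le> ((1 + 1 / c) * u) ^ q"
      using u v by (intro power_mono) (auto simp: algebra_simps)
    also have "\<dots> = (1 + 1 / c) ^ q * u ^ q" by (simp add: power_mult_distrib)
    finally show ?thesis using v by (simp add: add_increasing)
  qed
  then show ?thesis by (simp add: doubling_constant_def c_def)
qed

text \<open>
  The proof doubles the length \<open>N\<close> of the block. A partial sum that ends in the second half is the
  full sum \<open>S\<close> over the first half plus a partial sum of the second half, so with \<open>U\<close> and \<open>V\<close>
  dominating the two halves and \<open>C\<close> the constant, \<open>U + 2 V + C S\<^sup>q\<close> dominates the whole block.
  Its expectation is at most \<open>(1 + 2 + 1) C K N\<^sup>p\<close>, and the factor 4 is absorbed by
  \<open>(2 N)\<^sup>p\<close> because \<open>p \<ge> 2\<close>. Bounding by a dominating function \<open>W\<close> instead of the maximum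
  itself keeps the induction to sums of integrable functions.
\<close>

lemma dyadic_maximal_inequality:
  fixes \<xi> :: "nat \<Rightarrow> 'a \<Rightarrow> real"
  assumes q: "0 < q" and p: "2 \<le> p" and K: "0 \<le> K"
    and int: "\<And>a n. integrable M (\<lambda>\<omega>. \<bar>\<Sum>j=a..<a+n. \<xi> j \<omega>\<bar> ^ q)"
    and mom: "\<And>a n. (LINT \<omega>|M. \<bar>\<Sum>j=a..<a+n. \<xi> j \<omega>\<bar> ^ q) \<le> K * real n ^ p"
  shows "\<exists>W. integrable M W \<and> (\<forall>\<omega>. \<forall>k\<le>2^r. \<bar>\<Sum>j=a..<a+k. \<xi> j \<omega>\<bar> ^ q \<le> W \<omega>) \<and>
    (LINT \<omega>|M. W \<omega>) \<le> doubling_constant q * K * (2 ^ r) ^ p"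
proof (induction r arbitrary: a)
  case 0
  have C: "1 \<le> doubling_constant q" by (rule doubling_constant_ge_1[OF q])
  have "\<bar>\<Sum>j=a..<a+k. \<xi> j \<omega>\<bar> ^ q \<le> \<bar>\<Sum>j=a..<a+1. \<xi> j \<omega>\<bar> ^ q" if "k \<le> 2 ^ 0" for \<omega> k
  proof -
    have "k = 0 \<or> k = 1" using that by auto
    then show ?thesis using q by auto
  qed
  moreover have "K \<le> doubling_constant q * K" using C K by (simp add: mult_le_cancel_right1)
  ultimately show ?case
    using int[of a 1] mom[of a 1] by (intro exI[of _ "\<lambda>\<omega>. \<bar>\<Sum>j=a..<a+1. \<xi> j \<omega>\<bar> ^ q"]) auto
next
  case (Suc r)
  have C: "1 \<le> doubling_constant q" by (rule doubling_constant_ge_1[OF q])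
  define N where "N = (2::nat) ^ r"
  obtain U where U: "integrable M U" "\<And>\<omega> k. k \<le> N \<Longrightarrow> \<bar>\<Sum>j=a..<a+k. \<xi> j \<omega>\<bar> ^ q \<le> U \<omega>"
    "(LINT \<omega>|M. U \<omega>) \<le> doubling_constant q * K * (2 ^ r) ^ p"
    using Suc.IH[of a] unfolding N_def by blast
  obtain V where V: "integrable M V"
    "\<And>\<omega> k. k \<le> N \<Longrightarrow> \<bar>\<Sum>j=a+N..<(a+N)+k. \<xi> j \<omega>\<bar> ^ q \<le> V \<omega>"
    "(LINT \<omega>|M. V \<omega>) \<le> doubling_constant q * K * (2 ^ r) ^ p"
    using Suc.IH[of "a + N"] unfolding N_def by blast
  define S where "S \<omega> = \<bar>\<Sum>j=a..<a+N. \<xi> j \<omega>\<bar>" for \<omega>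
  define W where "W \<omega> = U \<omega> + 2 * V \<omega> + doubling_constant q * S \<omega> ^ q" for \<omega>
  have U0: "0 \<le> U \<omega>" and V0: "0 \<le> V \<omega>" for \<omega>
    using U(2)[of 0 \<omega>] V(2)[of 0 \<omega>] q by (auto simp: zero_power)
  have intS: "integrable M (\<lambda>\<omega>. S \<omega> ^ q)" unfolding S_def by (rule int)
  have intW: "integrable M W" unfolding W_def using U(1) V(1) intS by simp
  have dom: "\<bar>\<Sum>j=a..<a+k. \<xi> j \<omega>\<bar> ^ q \<le> W \<omega>" if k: "k \<le> 2 ^ Suc r" for \<omega> k
  proof (cases "k \<le> N")
    case True
    have "0 \<le> doubling_constant q * S \<omega> ^ q" using C by (simp add: S_def)
    then show ?thesis using U(2)[OF True, of \<omega>] V0[of \<omega>] unfolding W_def by linarith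
  next
    case False
    define l where "l = k - N"
    have l: "l \<le> N" "a + k = (a + N) + l" using False k by (auto simp: l_def N_def)
    define t where "t = \<bar>\<Sum>j=a+N..<(a+N)+l. \<xi> j \<omega>\<bar>"
    have "(\<Sum>j=a..<a+k. \<xi> j \<omega>) = (\<Sum>j=a..<a+N. \<xi> j \<omega>) + (\<Sum>j=a+N..<(a+N)+l. \<xi> j \<omega>)"
      unfolding l(2) by (rule sum.atLeastLessThan_concat[symmetric]) auto
    then have "\<bar>\<Sum>j=a..<a+k. \<xi> j \<omega>\<bar> \<le> S \<omega> + t" unfolding S_def t_def by linarith
    then have "\<bar>\<Sum>j=a..<a+k. \<xi> j \<omega>\<bar> ^ q \<le> (S \<omega> + t) ^ q" by (intro power_mono) auto
    also have "\<dots> \<le> 2 * t ^ q + doubling_constant q * S \<omega> ^ q"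
      by (rule power_add_le_twice_plus[OF q]) (auto simp: S_def t_def)
    also have "\<dots> \<le> W \<omega>" using V(2)[OF l(1), of \<omega>] U0[of \<omega>] unfolding W_def t_def by linarith
    finally show ?thesis .
  qed
  define D where "D = doubling_constant q * K * (2 ^ r) ^ p"
  have D0: "0 \<le> D" using C K by (simp add: D_def)
  have "(LINT \<omega>|M. W \<omega>) = (LINT \<omega>|M. U \<omega>) + 2 * (LINT \<omega>|M. V \<omega>) + doubling_constant q * (LINT \<omega>|M. S \<omega> ^ q)"
    unfolding W_def using U(1) V(1) intS by simp
  also have "\<dots> \<le> D + 2 * D + doubling_constant q * (K * real N ^ p)"
    using U(3) V(3) mom[of a N] C unfolding S_def D_def
    by (intro add_mono mult_left_mono) auto
  also have "\<dots> = 2\<^sup>2 * D" by (simp add: D_def N_def)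
  also have "\<dots> \<le> 2 ^ p * D" using p D0 by (intro mult_right_mono power_increasing) auto
  also have "\<dots> = doubling_constant q * K * (2 ^ Suc r) ^ p" by (simp add: D_def power_mult_distrib)
  finally show ?case using intW dom by blast
qed

section \<open>Moments of sums along an orbit\<close>

context invertible_prob_system
begin

lemma T_funpow_measurable [measurable]: "T ^^ n \<in> measurable M M"
proof (induction n)
  case (Suc n)
  show ?case using measurable_comp[OF Suc T_measurable] by (simp only: funpow.simps)
qed (simp add: id_def)

lemma T_funpow_space: "\<omega> \<in> space M \<Longrightarrow> (T ^^ n) \<omega> \<in> space M"
  using measurable_space[OF T_funpow_measurable] .

lemma distr_T_funpow: "distr M M (T ^^ n) = M"
proof (induction n)
  case 0
  show ?case by (simp add: id_def distr_id)
next
  case (Suc n)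
  have "distr M M (T ^^ Suc n) = distr (distr M M (T ^^ n)) M T"
    using distr_distr[OF T_measurable T_funpow_measurable[of n]] by (simp only: funpow.simps)
  then show ?case by (simp only: Suc T_preserving)
qed

lemma expectation_T_funpow:
  assumes "f \<in> borel_measurable M"
  shows "(LINT \<omega>|M. f ((T ^^ n) \<omega>)) = (LINT \<omega>|M. f \<omega> :: real)"
  using integral_distr[OF T_funpow_measurable assms, of n] by (simp add: distr_T_funpow)

text \<open>
  By invariance of the measure the sum may start at time 0, so that the powers of \<open>T\<close> match those
  of the moment sum; the observables keep their shifted index, which the supremum over \<open>G\<close> allows.
  Expanding the power then gives one product for each tuple of times. The bound \<open>B\<close> makes the
  suprema in the moment sum finite: in the reals an unbounded supremum would carry no information.
\<close>

lemma
  fixes G :: "('a \<Rightarrow> real) set"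
  assumes meas: "\<And>g. g \<in> G \<Longrightarrow> g \<in> borel_measurable M"
    and bound: "\<And>g \<omega>. g \<in> G \<Longrightarrow> \<omega> \<in> space M \<Longrightarrow> \<bar>g \<omega>\<bar> \<le> B"
    and h: "\<And>j. h j \<in> G"
  shows integrable_power_sum_along_orbit:
      "integrable M (\<lambda>\<omega>. (\<Sum>j=a..<a+n. h j ((T ^^ j) \<omega>)) ^ m)" (is ?int)
    and moment_le_moment_sum:
      "(LINT \<omega>|M. (\<Sum>j=a..<a+n. h j ((T ^^ j) \<omega>)) ^ m) \<le> moment_sum M T G m n" (is ?mom)
proof -
  have [measurable]: "h j \<in> borel_measurable M" for j by (rule meas[OF h])
  have intprod: "integrable M (\<lambda>\<omega>. \<Prod>i<m. g i ((T ^^ l i) \<omega>))"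
    and boundprod: "\<bar>LINT \<omega>|M. (\<Prod>i<m. g i ((T ^^ l i) \<omega>))\<bar> \<le> B ^ m"
    if g: "\<And>i. i < m \<Longrightarrow> g i \<in> G" for g and l :: "nat \<Rightarrow> nat"
  proof -
    have m: "(\<lambda>\<omega>. \<Prod>i<m. g i ((T ^^ l i) \<omega>)) \<in> borel_measurable M"
      using meas[OF g] by (intro borel_measurable_prod) (auto intro: measurable_compose[OF T_funpow_measurable])
    have b: "\<bar>\<Prod>i<m. g i ((T ^^ l i) \<omega>)\<bar> \<le> B ^ m" if "\<omega> \<in> space M" for \<omega>
    proof -
      have "(\<Prod>i<m. \<bar>g i ((T ^^ l i) \<omega>)\<bar>) \<le> (\<Prod>i<m. B)"
        using g that by (intro prod_mono) (auto intro: bound T_funpow_space)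
      then show ?thesis by (simp add: abs_prod)
    qed
    show i: "integrable M (\<lambda>\<omega>. \<Prod>i<m. g i ((T ^^ l i) \<omega>))"
      by (rule integrable_const_bound[of _ "B ^ m"]) (use m b in auto)
    have "\<bar>LINT \<omega>|M. (\<Prod>i<m. g i ((T ^^ l i) \<omega>))\<bar> \<le> (LINT \<omega>|M. \<bar>\<Prod>i<m. g i ((T ^^ l i) \<omega>)\<bar>)"
      by (rule integral_abs_bound)
    also have "\<dots> \<le> (LINT \<omega>|M. B ^ m)"
      using i b by (intro integral_mono) auto
    finally show "\<bar>LINT \<omega>|M. (\<Prod>i<m. g i ((T ^^ l i) \<omega>))\<bar> \<le> B ^ m" by (simp add: prob_space)
  qed
  let ?I = "{..<m} \<rightarrow>\<^sub>E {..<n}"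
  have shift: "(\<Sum>j=a..<a+n. h j ((T ^^ j) \<omega>)) = (\<Sum>j<n. h (a + j) ((T ^^ j) ((T ^^ a) \<omega>)))" for \<omega>
  proof -
    have "(\<Sum>j=a..<a+n. h j ((T ^^ j) \<omega>)) = (\<Sum>j<n. h (a + j) ((T ^^ (j + a)) \<omega>))"
      by (rule sum.reindex_bij_witness[of _ "\<lambda>j. a + j" "\<lambda>j. j - a"]) (auto simp: add.commute)
    then show ?thesis by (simp add: funpow_add)
  qed
  have expand: "(\<Sum>j<n. h (a + j) ((T ^^ j) \<omega>)) ^ m
      = (\<Sum>l\<in>?I. \<Prod>i<m. h (a + l i) ((T ^^ l i) \<omega>))" for \<omega>
    using prod_sum_PiE[of "{..<m}" "\<lambda>_. {..<n}" "\<lambda>_ j. h (a + j) ((T ^^ j) \<omega>)"] by simp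
  have int0: "integrable M (\<lambda>\<omega>. (\<Sum>j<n. h (a + j) ((T ^^ j) \<omega>)) ^ m)"
    unfolding expand by (intro Bochner_Integration.integrable_sum intprod h)
  have "integrable M (\<lambda>\<omega>. (\<Sum>j<n. h (a + j) ((T ^^ j) ((T ^^ a) \<omega>))) ^ m)"
    using integrable_distr[OF T_funpow_measurable[of a], of "\<lambda>\<omega>. (\<Sum>j<n. h (a + j) ((T ^^ j) \<omega>)) ^ m"] int0
    by (simp add: distr_T_funpow)
  then show ?int unfolding shift .
  have "(LINT \<omega>|M. (\<Sum>j=a..<a+n. h j ((T ^^ j) \<omega>)) ^ m)
      = (LINT \<omega>|M. (\<Sum>j<n. h (a + j) ((T ^^ j) \<omega>)) ^ m)"
    unfolding shift
    using expectation_T_funpow[of "\<lambda>\<omega>. (\<Sum>j<n. h (a + j) ((T ^^ j) \<omega>)) ^ m" a] int0 by auto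
  also have "\<dots> = (\<Sum>l\<in>?I. LINT \<omega>|M. (\<Prod>i<m. h (a + l i) ((T ^^ l i) \<omega>)))"
    unfolding expand by (intro Bochner_Integration.integral_sum intprod h)
  also have "\<dots> \<le> moment_sum M T G m n"
    unfolding moment_sum_def
  proof (rule sum_mono)
    fix l
    let ?g = "\<lambda>i\<in>{..<m}. h (a + l i)"
    let ?E = "\<lambda>g. \<bar>LINT \<omega>|M. (\<Prod>i<m. g i ((T ^^ l i) \<omega>))\<bar>"
    have "bdd_above (?E ` ({..<m} \<rightarrow>\<^sub>E G))"
      by (rule bdd_aboveI2[of _ _ "B ^ m"]) (rule boundprod, auto)
    then have "?E ?g \<le> (SUP g\<in>{..<m} \<rightarrow>\<^sub>E G. ?E g)"
      using h by (intro cSUP_upper) auto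
    moreover have "(\<Prod>i<m. ?g i ((T ^^ l i) \<omega>)) = (\<Prod>i<m. h (a + l i) ((T ^^ l i) \<omega>))" for \<omega>
      by (rule prod.cong) auto
    ultimately show "(LINT \<omega>|M. (\<Prod>i<m. h (a + l i) ((T ^^ l i) \<omega>))) \<le> (SUP g\<in>{..<m} \<rightarrow>\<^sub>E G. ?E g)"
      by simp
  qed
  finally show ?mom .
qed

end

text \<open>
  The Landau bound holds only for large \<open>N\<close>. It extends to all \<open>N\<close> because the finitely many
  remaining values can be added to the constant, except at \<open>N = 0\<close>, where the right-hand side is 0
  for \<open>p > 0\<close>; there the moment sum is empty since \<open>m > 0\<close>.
\<close>

lemma moment_sum_bound:
  assumes "(\<lambda>N. moment_sum M T G m N) \<in> O(\<lambda>N. real N ^ p)" and "0 < m"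
  obtains K where "0 \<le> K" "\<And>N. moment_sum M T G m N \<le> K * real N ^ p"
proof -
  obtain c where c: "c > 0" "eventually (\<lambda>N. norm (moment_sum M T G m N) \<le> c * norm (real N ^ p)) sequentially"
    using assms(1) by (elim landau_o.bigE)
  then obtain N0 where N0: "\<And>N. N \<ge> N0 \<Longrightarrow> \<bar>moment_sum M T G m N\<bar> \<le> c * real N ^ p"
    by (auto simp: eventually_sequentially)
  define s where "s = (\<Sum>N<N0. \<bar>moment_sum M T G m N\<bar>)"
  have s0: "0 \<le> s" by (simp add: s_def sum_nonneg)
  show ?thesis
  proof (rule that[of "c + s"])
    show "0 \<le> c + s" using c s0 by simp
    fix N
    consider "N = 0" | "N \<ge> N0" | "0 < N" "N < N0" by linarith
    then show "moment_sum M T G m N \<le> (c + s) * real N ^ p"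
    proof cases
      case 1
      have "({..<m} \<rightarrow>\<^sub>E {..<(0::nat)}) = {}" using assms(2) by (auto simp: PiE_eq_empty_iff)
      then show ?thesis using c s0 1 by (simp add: moment_sum_def)
    next
      case 2
      have "moment_sum M T G m N \<le> c * real N ^ p" using N0[OF 2] by simp
      also have "\<dots> \<le> (c + s) * real N ^ p" using s0 by (intro mult_right_mono) auto
      finally show ?thesis .
    next
      case 3
      have "moment_sum M T G m N \<le> \<bar>moment_sum M T G m N\<bar>" by simp
      also have "\<dots> \<le> s" unfolding s_def using 3 by (intro member_le_sum) auto
      also have "\<dots> \<le> (c + s) * 1" using c by simp
      also have "\<dots> \<le> (c + s) * real N ^ p" using c s0 3 by (intro mult_left_mono one_le_power) auto
      finally show ?thesis .
    qed
  qed
qed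

section \<open>Euler steps and a discrete Gronwall inequality\<close>

text \<open>
  Both are mean value inequalities: the first for \<open>y\<close>, the second for \<open>y\<close> minus the affine function
  with slope \<open>f (y a)\<close>, whose derivative is small because \<open>y\<close> has moved by at most
  \<open>B (b - a)\<close>. Derivatives are taken in the interior because the perturbed trajectory need not be
  differentiable at multiples of \<open>\<epsilon>\<close>.
\<close>

lemma
  fixes y :: "real \<Rightarrow> 'b::real_inner"
  assumes ab: "a \<le> b" and cont: "continuous_on {a..b} y"
    and deriv: "\<And>t. a < t \<Longrightarrow> t < b \<Longrightarrow> (y has_vector_derivative f (y t)) (at t)"
    and bound: "\<And>z. norm (f z) \<le> B"
  shows norm_increment_le: "norm (y b - y a) \<le> B * (b - a)"
    and euler_step_error: "L-lipschitz_on UNIV f \<Longrightarrow> norm (y b - y a - (b - a) *\<^sub>R f (y a)) \<le> L * B * (b - a)\<^sup>2"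
proof -
  have incr: "norm (y t - y a) \<le> B * (t - a)" if t: "a \<le> t" "t \<le> b" for t
  proof (cases "a = t")
    case False
    have "\<exists>s\<in>{a<..<t}. norm (y t - y a) \<le> norm ((t - a) *\<^sub>R f (y s))"
    proof (rule mvt_general)
      show "a < t" using False t by simp
      show "continuous_on {a..t} y" using cont t by (auto intro: continuous_on_subset)
      show "(y has_derivative (\<lambda>h. h *\<^sub>R f (y s))) (at s)" if "a < s" "s < t" for s
        using deriv[of s] that t by (simp add: has_vector_derivative_def)
    qed
    then obtain s where "norm (y t - y a) \<le> (t - a) * norm (f (y s))" using t by auto
    also have "\<dots> \<le> (t - a) * B" using t bound by (intro mult_left_mono) auto
    finally show ?thesis by (simp add: mult.commute)
  qed auto
  show "norm (y b - y a) \<le> B * (b - a)" using incr ab by simp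
  show "norm (y b - y a - (b - a) *\<^sub>R f (y a)) \<le> L * B * (b - a)\<^sup>2" if lip: "L-lipschitz_on UNIV f"
  proof (cases "a = b")
    case False
    define z where "z t = y t - t *\<^sub>R f (y a)" for t
    have "\<exists>s\<in>{a<..<b}. norm (z b - z a) \<le> norm ((b - a) *\<^sub>R (f (y s) - f (y a)))"
    proof (rule mvt_general)
      show "a < b" using False ab by simp
      show "continuous_on {a..b} z" unfolding z_def by (intro continuous_intros cont)
      show "(z has_derivative (\<lambda>h. h *\<^sub>R (f (y s) - f (y a)))) (at s)" if "a < s" "s < b" for s
      proof -
        have "(z has_vector_derivative (f (y s) - 1 *\<^sub>R f (y a))) (at s)"
          unfolding z_def using that
          by (auto intro!: derivative_eq_intros deriv)
        then show ?thesis by (simp add: has_vector_derivative_def)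
      qed
    qed
    then obtain s where s: "a < s" "s < b" "norm (z b - z a) \<le> (b - a) * norm (f (y s) - f (y a))"
      using ab by auto
    have L0: "0 \<le> L" and B0: "0 \<le> B"
      using lip lipschitz_on_nonneg order_trans[OF norm_ge_zero bound] by blast+
    have "norm (f (y s) - f (y a)) \<le> L * norm (y s - y a)"
      using lipschitz_onD[OF lip, of "y s" "y a"] by (simp add: dist_norm)
    also have "\<dots> \<le> L * (B * (b - a))"
      using incr[of s] s L0 B0 by (intro mult_left_mono) (auto intro!: order_trans[OF incr mult_left_mono])
    finally have "(b - a) * norm (f (y s) - f (y a)) \<le> (b - a) * (L * (B * (b - a)))"
      using ab by (intro mult_left_mono) auto
    moreover have "z b - z a = y b - y a - (b - a) *\<^sub>R f (y a)"
      by (simp add: z_def algebra_simps)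
    ultimately show ?thesis using s(3) by (simp add: power2_eq_square mult_ac)
  qed auto
qed

lemma discrete_gronwall:
  fixes u :: "nat \<Rightarrow> real"
  assumes "\<And>k. k \<le> n \<Longrightarrow> u k \<le> \<beta> + c * (\<Sum>j<k. u j)" and "0 \<le> c" and "k \<le> n"
  shows "u k \<le> \<beta> * (1 + c) ^ k"
  using assms(3)
proof (induction k rule: less_induct)
  case (less k)
  have geo: "\<beta> + c * (\<Sum>j<i. \<beta> * (1 + c) ^ j) = \<beta> * (1 + c) ^ i" for i
    by (induction i) (auto simp: algebra_simps)
  have "u k \<le> \<beta> + c * (\<Sum>j<k. u j)" using assms(1) less by simp
  also have "\<dots> \<le> \<beta> + c * (\<Sum>j<k. \<beta> * (1 + c) ^ j)"
    using less assms(2) by (intro add_left_mono mult_left_mono sum_mono) auto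
  finally show ?case by (simp add: geo)
qed

text \<open>
  The forcing \<open>b\<close> enters through its partial sums and not through the sum of its norms: summing the
  recursion before taking norms preserves the cancellation among the \<open>b j\<close>.
\<close>

lemma perturbed_recursion_bound:
  fixes e :: "nat \<Rightarrow> 'b::real_normed_vector" and n :: nat and \<epsilon> L R S :: real
  assumes e0: "e 0 = 0"
    and step: "\<And>k. k < n \<Longrightarrow> norm (e (Suc k) - e k - \<epsilon> *\<^sub>R (a k + b k)) \<le> R"
    and a: "\<And>k. k < n \<Longrightarrow> norm (a k) \<le> L * norm (e k)"
    and b: "\<And>k. k \<le> n \<Longrightarrow> norm (\<Sum>j<k. b j) \<le> S"
    and nn: "0 \<le> \<epsilon>" "0 \<le> L" "0 \<le> R" and k: "k \<le> n"
  shows "norm (e k) \<le> (\<epsilon> * S + n * R) * exp (\<epsilon> * L * n)"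
proof -
  have S0: "0 \<le> S" using b[of 0] by simp
  have sum: "norm (e k - \<epsilon> *\<^sub>R (\<Sum>j<k. a j + b j)) \<le> k * R" if "k \<le> n" for k
    using that
  proof (induction k)
    case (Suc k)
    have split: "e (Suc k) - \<epsilon> *\<^sub>R (\<Sum>j<Suc k. a j + b j)
        = (e k - \<epsilon> *\<^sub>R (\<Sum>j<k. a j + b j)) + (e (Suc k) - e k - \<epsilon> *\<^sub>R (a k + b k))"
      by (simp add: algebra_simps)
    have "norm (e (Suc k) - \<epsilon> *\<^sub>R (\<Sum>j<Suc k. a j + b j)) \<le> k * R + R"
      unfolding split using Suc by (intro norm_triangle_mono step) auto
    then show ?case by (simp only: of_nat_Suc) (simp add: algebra_simps)
  qed (simp add: e0)
  have "norm (e k) \<le> (\<epsilon> * S + n * R) + (\<epsilon> * L) * (\<Sum>j<k. norm (e j))" if k: "k \<le> n" for k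
  proof -
    have "norm (e k) \<le> norm (e k - \<epsilon> *\<^sub>R (\<Sum>j<k. a j + b j)) + norm (\<epsilon> *\<^sub>R (\<Sum>j<k. a j + b j))"
      using norm_triangle_ineq[of "e k - \<epsilon> *\<^sub>R (\<Sum>j<k. a j + b j)" "\<epsilon> *\<^sub>R (\<Sum>j<k. a j + b j)"]
      by (simp only: diff_add_cancel)
    also have "\<dots> \<le> k * R + \<epsilon> * (norm (\<Sum>j<k. a j) + norm (\<Sum>j<k. b j))"
      using sum[OF k] nn by (intro add_mono) (auto simp: sum.distrib intro!: mult_left_mono norm_triangle_ineq)
    also have "\<dots> \<le> n * R + \<epsilon> * ((\<Sum>j<k. L * norm (e j)) + S)"
      using k nn a b[OF k]
      by (intro add_mono mult_left_mono mult_right_mono sum_norm_le) auto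
    finally show ?thesis by (simp add: algebra_simps sum_distrib_left)
  qed
  then have "norm (e k) \<le> (\<epsilon> * S + n * R) * (1 + \<epsilon> * L) ^ k"
    using k nn by (intro discrete_gronwall[where n=n]) auto
  also have "\<dots> \<le> (\<epsilon> * S + n * R) * exp (\<epsilon> * L * n)"
  proof (rule mult_left_mono)
    have "(1 + \<epsilon> * L) ^ k \<le> exp (\<epsilon> * L) ^ k" using nn by (intro power_mono) auto
    also have "\<dots> = exp (\<epsilon> * L * k)" by (simp add: exp_of_nat_mult mult.commute)
    also have "\<dots> \<le> exp (\<epsilon> * L * n)" using k nn by (simp add: mult_left_mono)
    finally show "(1 + \<epsilon> * L) ^ k \<le> exp (\<epsilon> * L * n)" .
  qed (use nn S0 in simp)
  finally show ?thesis .
qed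

section \<open>The averaging error\<close>

text \<open>
  Monotonicity of the nonnegative integral against the integrable \<open>V\<close> suffices, so that nothing has to be
  known about the measurability of \<open>f\<close>, in the application a supremum over uncountably many times.
\<close>

lemma Lq_norm_le_root:
  assumes q: "0 < q" and int: "integrable M V" and V0: "\<And>\<omega>. \<omega> \<in> space M \<Longrightarrow> 0 \<le> V \<omega>"
    and f: "\<And>\<omega>. \<omega> \<in> space M \<Longrightarrow> f \<omega> \<le> ennreal (root q (V \<omega>))"
    and c: "(LINT \<omega>|M. V \<omega>) \<le> c"
  shows "Lq_norm q M f \<le> ennreal (root q c)"
proof -
  have "(\<integral>\<^sup>+ \<omega>. f \<omega> ^ q \<partial>M) \<le> (\<integral>\<^sup>+ \<omega>. ennreal (V \<omega>) \<partial>M)"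
  proof (rule nn_integral_mono)
    fix \<omega> assume w: "\<omega> \<in> space M"
    have "f \<omega> ^ q \<le> ennreal (root q (V \<omega>)) ^ q" using f[OF w] by (intro power_mono) auto
    also have "\<dots> = ennreal (V \<omega>)" using V0[OF w] q by (simp add: ennreal_power)
    finally show "f \<omega> ^ q \<le> ennreal (V \<omega>)" .
  qed
  also have "\<dots> = ennreal (LINT \<omega>|M. V \<omega>)"
    using V0 by (intro nn_integral_eq_integral int) auto
  also have "\<dots> \<le> ennreal c" using c by (rule ennreal_leI)
  finally have le: "(\<integral>\<^sup>+ \<omega>. f \<omega> ^ q \<partial>M) \<le> ennreal c" .
  have c0: "0 \<le> c" using c V0 by (intro order_trans[OF Bochner_Integration.integral_nonneg c]) auto
  have fin: "(\<integral>\<^sup>+ \<omega>. f \<omega> ^ q \<partial>M) \<noteq> \<infinity>" using le ennreal_less_top neq_top_trans by (metis ennreal_neq_top infinity_ennreal_def)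
  have "enn2real (\<integral>\<^sup>+ \<omega>. f \<omega> ^ q \<partial>M) \<le> c" using le c0 by (rule enn2real_leI[rotated])
  then show ?thesis using fin q by (auto simp: Lq_norm_def Let_def intro!: ennreal_leI)
qed


locale bounded_lipschitz_field = invertible_prob_system M T
  for M :: "'a measure" and T :: "'a \<Rightarrow> 'a" +
  fixes F :: "real^'d \<Rightarrow> 'a \<Rightarrow> real^'d" and B L :: real
  assumes F_measurable [measurable]: "\<And>x. F x \<in> borel_measurable M"
    and F_bound: "\<And>x \<omega>. \<omega> \<in> space M \<Longrightarrow> norm (F x \<omega>) \<le> B"
    and F_lipschitz: "\<And>\<omega>. \<omega> \<in> space M \<Longrightarrow> L-lipschitz_on UNIV (\<lambda>x. F x \<omega>)"
begin

lemma B_nonneg: "0 \<le> B"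
  using not_empty F_bound order_trans[OF norm_ge_zero] by blast

lemma L_nonneg: "0 \<le> L"
  using not_empty F_lipschitz lipschitz_on_nonneg by blast

lemma F_integrable: "integrable M (F x)"
  by (rule integrable_const_bound[of _ B]) (auto simp: F_bound)

lemma averaged_field_bound: "norm (averaged_field M F x) \<le> B"
proof -
  have "norm (averaged_field M F x) \<le> (LINT \<omega>|M. norm (F x \<omega>))"
    unfolding averaged_field_def by (rule integral_norm_bound)
  also have "\<dots> \<le> (LINT \<omega>|M. B)"
    by (intro integral_mono integrable_norm F_integrable) (auto simp: F_bound)
  finally show ?thesis by (simp add: prob_space)
qed

lemma averaged_field_lipschitz: "L-lipschitz_on UNIV (averaged_field M F)"
proof (rule lipschitz_onI)
  fix x y
  have "norm (averaged_field M F x - averaged_field M F y) = norm (LINT \<omega>|M. F x \<omega> - F y \<omega>)"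
    unfolding averaged_field_def by (simp add: F_integrable)
  also have "\<dots> \<le> (LINT \<omega>|M. norm (F x \<omega> - F y \<omega>))" by (rule integral_norm_bound)
  also have "\<dots> \<le> (LINT \<omega>|M. L * dist x y)"
    using lipschitz_onD[OF F_lipschitz, of _ x y]
    by (intro integral_mono integrable_norm Bochner_Integration.integrable_diff F_integrable)
      (auto simp: dist_norm)
  finally show "dist (averaged_field M F x) (averaged_field M F y) \<le> L * dist x y"
    by (simp add: prob_space dist_norm)
qed (rule L_nonneg)

lemma centered_coordinates_measurable:
  "g \<in> centered_coordinates M F \<Longrightarrow> g \<in> borel_measurable M"
  unfolding centered_coordinates_def centered_field_def
  by (auto intro!: borel_measurable_diff simp: vector_minus_component
      intro: measurable_compose[OF F_measurable borel_measurable_continuous_onI[OF continuous_on_component]])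

lemma centered_coordinates_bound:
  assumes "g \<in> centered_coordinates M F" "\<omega> \<in> space M"
  shows "\<bar>g \<omega>\<bar> \<le> 2 * B"
proof -
  obtain x i where g: "g = (\<lambda>\<omega>. centered_field M F x \<omega> $ i)"
    using assms(1) by (auto simp: centered_coordinates_def)
  have "\<bar>g \<omega>\<bar> \<le> norm (centered_field M F x \<omega>)" unfolding g by (rule component_le_norm_cart)
  also have "\<dots> \<le> norm (F x \<omega>) + norm (averaged_field M F x)"
    unfolding centered_field_def by (rule norm_triangle_ineq4)
  finally show ?thesis using F_bound[OF assms(2), of x] averaged_field_bound[of x] by linarith
qed

text \<open>
  The maximal inequality is applied to each coordinate. Asking for \<open>V \<ge> 1\<close> is harmless for the
  expectation and lets the same \<open>V\<close> absorb the deterministic part of the averaging error.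
\<close>

lemma dominated_centered_sums:
  assumes p: "2 \<le> p" and q: "0 < q" "even q"
    and K: "0 \<le> K" "\<And>N. moment_sum M T (centered_coordinates M F) q N \<le> K * real N ^ p"
  shows "\<exists>V. integrable M V \<and> (\<forall>\<omega>. 1 \<le> V \<omega>) \<and>
    (LINT \<omega>|M. V \<omega>) \<le> 1 + CARD('d) * (doubling_constant q * K) * (2 ^ r) ^ p \<and>
    (\<forall>\<omega>. \<forall>k\<le>2^r. norm (\<Sum>j<k. centered_field M F (z j) ((T ^^ j) \<omega>)) \<le> CARD('d) * root q (V \<omega>))"
proof -
  let ?G = "centered_coordinates M F"
  let ?C = "doubling_constant q"
  define \<xi> where "\<xi> i j \<omega> = centered_field M F (z j) ((T ^^ j) \<omega>) $ i" for i j \<omega>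
  have "\<exists>W. integrable M W \<and> (\<forall>\<omega>. \<forall>k\<le>2^r. \<bar>\<Sum>j=0..<0+k. \<xi> i j \<omega>\<bar> ^ q \<le> W \<omega>) \<and>
      (LINT \<omega>|M. W \<omega>) \<le> ?C * K * (2 ^ r) ^ p" for i
  proof (rule dyadic_maximal_inequality[OF q(1) p K(1)])
    define h where "h j \<omega> = centered_field M F (z j) \<omega> $ i" for j \<omega>
    have h: "h j \<in> ?G" for j unfolding h_def centered_coordinates_def by blast
    have \<xi>: "\<bar>\<Sum>j=a..<a+n. \<xi> i j \<omega>\<bar> ^ q = (\<Sum>j=a..<a+n. h j ((T ^^ j) \<omega>)) ^ q" for a n \<omega>
      using q(2) by (simp add: power_even_abs \<xi>_def h_def)
    show "integrable M (\<lambda>\<omega>. \<bar>\<Sum>j=a..<a+n. \<xi> i j \<omega>\<bar> ^ q)" for a n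
      unfolding \<xi> by (rule integrable_power_sum_along_orbit[where G="?G" and B="2 * B" and h=h])
        (use centered_coordinates_measurable centered_coordinates_bound h in auto)
    show "(LINT \<omega>|M. \<bar>\<Sum>j=a..<a+n. \<xi> i j \<omega>\<bar> ^ q) \<le> K * real n ^ p" for a n
      unfolding \<xi> by (rule order_trans[OF moment_le_moment_sum[where G="?G" and B="2 * B" and h=h] K(2)])
        (use centered_coordinates_measurable centered_coordinates_bound h in auto)
  qed
  then obtain W where W: "\<And>i. integrable M (W i)"
    "\<And>i \<omega> k. k \<le> 2 ^ r \<Longrightarrow> \<bar>\<Sum>j<k. \<xi> i j \<omega>\<bar> ^ q \<le> W i \<omega>"
    "\<And>i. (LINT \<omega>|M. W i \<omega>) \<le> ?C * K * (2 ^ r) ^ p"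
    unfolding add_0 lessThan_atLeast0 by metis
  have W0: "0 \<le> W i \<omega>" for i \<omega> using W(2)[of 0 i \<omega>] q by (simp add: zero_power)
  define V where "V \<omega> = 1 + (\<Sum>i\<in>UNIV. W i \<omega>)" for \<omega>
  have le: "norm (\<Sum>j<k. centered_field M F (z j) ((T ^^ j) \<omega>)) \<le> CARD('d) * root q (V \<omega>)"
    if k: "k \<le> 2 ^ r" for \<omega> k
  proof -
    let ?s = "\<Sum>j<k. centered_field M F (z j) ((T ^^ j) \<omega>)"
    have "\<bar>?s $ i\<bar> \<le> root q (V \<omega>)" for i
    proof -
      have "\<bar>?s $ i\<bar> ^ q \<le> W i \<omega>" using W(2)[OF k, of i \<omega>] by (simp add: \<xi>_def)
      also have "\<dots> \<le> (\<Sum>i\<in>UNIV. W i \<omega>)" using W0 by (intro member_le_sum) auto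
      also have "\<dots> \<le> V \<omega>" by (simp add: V_def)
      finally have "root q (\<bar>?s $ i\<bar> ^ q) \<le> root q (V \<omega>)" using q by simp
      then show ?thesis using q(1) by (simp only: real_root_power_cancel[OF q(1) abs_ge_zero])
    qed
    then have "(\<Sum>i\<in>UNIV. \<bar>?s $ i\<bar>) \<le> (\<Sum>i\<in>(UNIV :: 'd set). root q (V \<omega>))" by (intro sum_mono)
    then show ?thesis using norm_le_l1_cart[of ?s] by simp
  qed
  have "(LINT \<omega>|M. V \<omega>) = 1 + (\<Sum>i\<in>UNIV. LINT \<omega>|M. W i \<omega>)"
    unfolding V_def using W(1) by (simp add: prob_space)
  also have "\<dots> \<le> 1 + (\<Sum>i\<in>(UNIV :: 'd set). ?C * K * (2 ^ r) ^ p)"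
    using W(3) by (intro add_left_mono sum_mono)
  finally have "(LINT \<omega>|M. V \<omega>) \<le> 1 + CARD('d) * (?C * K) * (2 ^ r) ^ p" by simp
  moreover have "integrable M V" unfolding V_def using W(1) by simp
  moreover have "1 \<le> V \<omega>" for \<omega> using W0 by (simp add: V_def sum_nonneg)
  ultimately show "\<exists>V. integrable M V \<and> (\<forall>\<omega>. 1 \<le> V \<omega>) \<and>
    (LINT \<omega>|M. V \<omega>) \<le> 1 + CARD('d) * (?C * K) * (2 ^ r) ^ p \<and>
    (\<forall>\<omega>. \<forall>k\<le>2^r. norm (\<Sum>j<k. centered_field M F (z j) ((T ^^ j) \<omega>)) \<le> CARD('d) * root q (V \<omega>))"
    using le by blast
qed

lemma perturbed_solution_on_step:
  assumes "perturbed_solution T F \<epsilon> x \<omega> y" and "0 < \<epsilon>" and t: "\<epsilon> * real k < t" "t < \<epsilon> * real (Suc k)"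
  shows "(y has_vector_derivative F (y t) ((T ^^ k) \<omega>)) (at t)"
proof -
  have b: "real k < t / \<epsilon>" "t / \<epsilon> < real k + 1" using assms by (auto simp: field_simps)
  then have fl: "\<lfloor>t / \<epsilon>\<rfloor> = int k" by (intro floor_unique) auto
  have "t \<notin> range (\<lambda>k::int. \<epsilon> * of_int k)"
  proof
    assume "t \<in> range (\<lambda>k::int. \<epsilon> * of_int k)"
    then obtain m :: int where "t = \<epsilon> * of_int m" by auto
    then have "t / \<epsilon> = of_int m" using assms(2) by simp
    moreover have "m = int k" using fl calculation by simp
    ultimately show False using b by simp
  qed
  moreover have "0 \<le> t" using t(1) mult_nonneg_nonneg[of \<epsilon> "real k"] assms(2) by linarith
  ultimately show ?thesis using assms(1) fl unfolding perturbed_solution_def by force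
qed

text \<open>
  In the recursion for the error on the grid, \<open>a k\<close> compares the field at the two trajectories and
  \<open>b k\<close> is the centered field on the averaged one. The term \<open>2 B\<close> is the motion of the two
  trajectories since the last grid point before \<open>t\<close>; the term \<open>2 L B T0\<close> collects the Euler errors
  of at most \<open>T0 / \<epsilon>\<close> steps.
\<close>

lemma error_le_centered_sums:
  assumes \<omega>: "\<omega> \<in> space M" and \<epsilon>: "0 < \<epsilon>"
    and y: "perturbed_solution T F \<epsilon> x \<omega> y" and v: "averaged_solution M F x v"
    and S: "\<And>k. \<epsilon> * real k \<le> T0 \<Longrightarrow> norm (\<Sum>j<k. centered_field M F (v (\<epsilon> * real j)) ((T ^^ j) \<omega>)) \<le> S"
    and t: "0 \<le> t" "t \<le> T0"
  shows "norm (y t - v t) \<le> \<epsilon> * ((S + 2 * L * B * T0) * exp (L * T0) + 2 * B)"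
proof -
  define n where "n = nat \<lfloor>t / \<epsilon>\<rfloor>"
  have n: "\<epsilon> * real n \<le> t" "t < \<epsilon> * real (Suc n)"
  proof -
    have "real n \<le> t / \<epsilon>" "t / \<epsilon> < real n + 1" using t \<epsilon> unfolding n_def by (auto simp: of_nat_nat)
    then show "\<epsilon> * real n \<le> t" "t < \<epsilon> * real (Suc n)" using \<epsilon> by (auto simp: field_simps)
  qed
  define e where "e k = y (\<epsilon> * real k) - v (\<epsilon> * real k)" for k
  define a where "a k = F (y (\<epsilon> * real k)) ((T ^^ k) \<omega>) - F (v (\<epsilon> * real k)) ((T ^^ k) \<omega>)" for k
  define b where "b k = centered_field M F (v (\<epsilon> * real k)) ((T ^^ k) \<omega>)" for k
  have cont_y: "continuous_on {0..} y" using y by (simp add: perturbed_solution_def)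
  have dv0: "(v has_vector_derivative averaged_field M F (v s)) (at s within {0..})" if "0 \<le> s" for s
    using v that unfolding averaged_solution_def by blast
  have cont_v: "continuous_on {0..} v"
    unfolding continuous_on_eq_continuous_within
    using has_vector_derivative_continuous[OF dv0] by simp
  have dv: "(v has_vector_derivative averaged_field M F (v s)) (at s)" if "0 < s" for s
  proof -
    have "at s within {0..} = at s" using that by (intro at_within_interior) simp
    then show ?thesis using dv0[of s] that by simp
  qed
  have pos: "0 \<le> \<epsilon> * real k" for k using \<epsilon> by simp
  have sub: "{\<epsilon> * real k..c} \<subseteq> {0..}" for k c using pos[of k] by auto
  have dy: "(y has_vector_derivative F (y s) ((T ^^ k) \<omega>)) (at s)"
    if "\<epsilon> * real k < s" "s < c" "c \<le> \<epsilon> * real (Suc k)" for k s c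
    using perturbed_solution_on_step[OF y \<epsilon>] that by simp
  have dv': "(v has_vector_derivative averaged_field M F (v s)) (at s)"
    if "\<epsilon> * real k < s" for k s
    using dv pos[of k] that by simp
  note F_k = F_bound[OF T_funpow_space[OF \<omega>]] F_lipschitz[OF T_funpow_space[OF \<omega>]]
  have step: "norm (e (Suc k) - e k - \<epsilon> *\<^sub>R (a k + b k)) \<le> 2 * L * B * \<epsilon>\<^sup>2" for k
  proof -
    let ?s = "\<epsilon> * real k" and ?s' = "\<epsilon> * real (Suc k)"
    have len: "?s' - ?s = \<epsilon>" "?s \<le> ?s'" using \<epsilon> by (auto simp: algebra_simps)
    have "norm (y ?s' - y ?s - (?s' - ?s) *\<^sub>R F (y ?s) ((T ^^ k) \<omega>)) \<le> L * B * (?s' - ?s)\<^sup>2"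
    proof (rule euler_step_error[where f="\<lambda>z. F z ((T ^^ k) \<omega>)"])
      show "continuous_on {?s..?s'} y" by (rule continuous_on_subset[OF cont_y sub])
    qed (use F_k len(2) dy[OF _ _ order_refl] in auto)
    moreover have "norm (v ?s' - v ?s - (?s' - ?s) *\<^sub>R averaged_field M F (v ?s)) \<le> L * B * (?s' - ?s)\<^sup>2"
    proof (rule euler_step_error[where f="averaged_field M F"])
      show "continuous_on {?s..?s'} v" by (rule continuous_on_subset[OF cont_v sub])
    qed (use averaged_field_bound averaged_field_lipschitz len(2) dv' in auto)
    ultimately have "norm ((y ?s' - y ?s - \<epsilon> *\<^sub>R F (y ?s) ((T ^^ k) \<omega>))
        - (v ?s' - v ?s - \<epsilon> *\<^sub>R averaged_field M F (v ?s))) \<le> L * B * \<epsilon>\<^sup>2 + L * B * \<epsilon>\<^sup>2"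
      unfolding len(1) by (rule order_trans[OF norm_triangle_ineq4 add_mono])
    moreover have "e (Suc k) - e k - \<epsilon> *\<^sub>R (a k + b k)
        = (y ?s' - y ?s - \<epsilon> *\<^sub>R F (y ?s) ((T ^^ k) \<omega>)) - (v ?s' - v ?s - \<epsilon> *\<^sub>R averaged_field M F (v ?s))"
      unfolding e_def a_def b_def centered_field_def by (simp add: scaleR_right_diff_distrib del: of_nat_Suc)
    ultimately show ?thesis by (simp only:)
  qed
  have "norm (e n) \<le> (\<epsilon> * S + real n * (2 * L * B * \<epsilon>\<^sup>2)) * exp (\<epsilon> * L * real n)"
  proof (rule perturbed_recursion_bound[where a=a and b=b])
    show "e 0 = 0" using y v by (simp add: e_def perturbed_solution_def averaged_solution_def)
    show "norm (a k) \<le> L * norm (e k)" for k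
      using lipschitz_onD[OF F_k(2), of "y (\<epsilon> * real k)" "v (\<epsilon> * real k)" k]
      by (simp add: a_def e_def dist_norm)
    show "norm (\<Sum>j<k. b j) \<le> S" if "k \<le> n" for k
    proof -
      have "\<epsilon> * real k \<le> \<epsilon> * real n" using that \<epsilon> by simp
      then show ?thesis unfolding b_def using n t by (intro S) linarith
    qed
  qed (use step \<epsilon> L_nonneg B_nonneg in auto)
  also have "\<dots> \<le> (\<epsilon> * S + \<epsilon> * (2 * L * B * T0)) * exp (L * T0)"
  proof (rule mult_mono)
    have nT: "\<epsilon> * real n \<le> T0" using n t by linarith
    have "real n * (2 * L * B * \<epsilon>\<^sup>2) = \<epsilon> * (2 * L * B * (\<epsilon> * real n))"
      by (simp add: power2_eq_square)
    also have "\<dots> \<le> \<epsilon> * (2 * L * B * T0)"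
      using nT \<epsilon> L_nonneg B_nonneg by (intro mult_left_mono) auto
    finally show "\<epsilon> * S + real n * (2 * L * B * \<epsilon>\<^sup>2) \<le> \<epsilon> * S + \<epsilon> * (2 * L * B * T0)"
      by (rule add_left_mono)
    have "\<epsilon> * L * real n \<le> L * T0"
      using mult_left_mono[OF nT L_nonneg] by (simp add: mult_ac)
    then show "exp (\<epsilon> * L * real n) \<le> exp (L * T0)" by simp
    have "0 \<le> S" using S[of 0] t by simp
    then show "0 \<le> \<epsilon> * S + \<epsilon> * (2 * L * B * T0)"
      using \<epsilon> L_nonneg B_nonneg t by simp
  qed simp
  finally have en: "norm (e n) \<le> \<epsilon> * ((S + 2 * L * B * T0) * exp (L * T0))" by (simp add: algebra_simps)
  have Bt: "B * (t - \<epsilon> * real n) \<le> B * \<epsilon>"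
    using n B_nonneg by (intro mult_left_mono) (auto simp: algebra_simps)
  have "norm (y t - y (\<epsilon> * real n)) \<le> B * (t - \<epsilon> * real n)"
  proof (rule norm_increment_le[where f="\<lambda>z. F z ((T ^^ n) \<omega>)"])
    show "continuous_on {\<epsilon> * real n..t} y" by (rule continuous_on_subset[OF cont_y sub])
  qed (use n F_k dy[OF _ _ less_imp_le[OF n(2)]] in auto)
  moreover have "norm (v t - v (\<epsilon> * real n)) \<le> B * (t - \<epsilon> * real n)"
  proof (rule norm_increment_le[where f="averaged_field M F"])
    show "continuous_on {\<epsilon> * real n..t} v" by (rule continuous_on_subset[OF cont_v sub])
  qed (use n averaged_field_bound dv' in auto)
  moreover have "y t - v t = e n + ((y t - y (\<epsilon> * real n)) - (v t - v (\<epsilon> * real n)))"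
    by (simp add: e_def)
  then have "norm (y t - v t) \<le> norm (e n) + (norm (y t - y (\<epsilon> * real n)) + norm (v t - v (\<epsilon> * real n)))"
    by (simp only:) (intro norm_triangle_mono order_refl norm_triangle_ineq4)
  ultimately have "norm (y t - v t) \<le> \<epsilon> * ((S + 2 * L * B * T0) * exp (L * T0)) + 2 * (B * \<epsilon>)"
    using en Bt by linarith
  then show ?thesis by (simp add: algebra_simps)
qed

text \<open>
  The number of steps is rounded up to a power of 2, which multiplies \<open>T0 / \<epsilon>\<close> by about 2 and
  accounts for \<open>Q\<close>. With \<open>A\<close> the deterministic factor in the pathwise bound, the moment of order
  \<open>2 p\<close> of the error is at most \<open>(\<epsilon> A)\<^bsup>2p\<^esup> (1 + D (Q / \<epsilon>)\<^sup>p)\<close>, which is of order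
  \<open>\<epsilon>\<^sup>p\<close>; the root of order \<open>2 p\<close> turns this into \<open>sqrt \<epsilon>\<close>.
\<close>

lemma Lq_norm_error_le:
  assumes p: "2 \<le> p" and T0: "0 \<le> T0"
    and K: "0 \<le> K" "\<And>N. moment_sum M T (centered_coordinates M F) (2 * p) N \<le> K * real N ^ p"
  shows "\<exists>c. \<forall>\<epsilon> x X v. 0 < \<epsilon> \<and> \<epsilon> \<le> 1 \<and> (\<forall>\<omega>\<in>space M. perturbed_solution T F \<epsilon> x \<omega> (X \<omega>)) \<and>
      averaged_solution M F x v \<longrightarrow>
    Lq_norm (2 * p) M (\<lambda>\<omega>. SUP t\<in>{0..T0}. ennreal (infnorm (X \<omega> t - v t))) \<le> ennreal (c * sqrt \<epsilon>)"
proof -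
  let ?q = "2 * p"
  have q: "0 < ?q" "even ?q" using p by auto
  define D where "D = CARD('d) * (doubling_constant ?q * K)"
  have D: "0 \<le> D" using doubling_constant_ge_1[OF q(1)] K(1) by (simp add: D_def)
  define A where "A = (CARD('d) + 2 * L * B * T0) * exp (L * T0) + 2 * B"
  define Q where "Q = 2 * T0 + 1"
  have A0: "0 \<le> A" using L_nonneg B_nonneg T0 by (simp add: A_def)
  show ?thesis
  proof (intro exI[of _ "root ?q (A ^ ?q * (1 + D * Q ^ p))"] allI impI, elim conjE)
    fix \<epsilon> x X v
    assume \<epsilon>: "0 < \<epsilon>" "\<epsilon> \<le> 1" and "\<forall>\<omega>\<in>space M. perturbed_solution T F \<epsilon> x \<omega> (X \<omega>)"
      and v: "averaged_solution M F x v"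
    then have X: "perturbed_solution T F \<epsilon> x \<omega> (X \<omega>)" if "\<omega> \<in> space M" for \<omega> using that by blast
    define n where "n = nat \<lfloor>T0 / \<epsilon>\<rfloor>"
    have n: "real n \<le> T0 / \<epsilon>" using T0 \<epsilon> by (simp add: n_def)
    obtain r where r: "n \<le> 2 ^ r" "2 ^ r \<le> 2 * n + 1"
    proof (cases "n = 0")
      case True
      then show ?thesis using that[of 0] by simp
    next
      case False
      then obtain s where "2 ^ s \<le> n" "n < 2 ^ (s + 1)" using ex_power_ivl1[of 2 n] by auto
      then show ?thesis using that[of "s + 1"] by simp
    qed
    obtain V where V: "integrable M V" "\<And>\<omega>. 1 \<le> V \<omega>" "(LINT \<omega>|M. V \<omega>) \<le> 1 + D * (2 ^ r) ^ p"
      "\<And>\<omega> k. k \<le> 2 ^ r \<Longrightarrow>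
        norm (\<Sum>j<k. centered_field M F (v (\<epsilon> * real j)) ((T ^^ j) \<omega>)) \<le> CARD('d) * root ?q (V \<omega>)"
      using dominated_centered_sums[OF p q K, of r "\<lambda>j. v (\<epsilon> * real j)"] unfolding D_def by blast
    have "\<epsilon> * 2 ^ r \<le> Q"
    proof -
      have "real (2 ^ r) \<le> real (2 * n + 1)" using r(2) by (simp only: of_nat_le_iff)
      then have "\<epsilon> * 2 ^ r \<le> \<epsilon> * (2 * (T0 / \<epsilon>) + 1)" using n \<epsilon> by (intro mult_left_mono) auto
      also have "\<dots> = 2 * T0 + \<epsilon>" using \<epsilon> by (simp add: field_simps)
      finally show ?thesis using \<epsilon> by (simp add: Q_def)
    qed
    then have Qp: "(\<epsilon> * 2 ^ r) ^ p \<le> Q ^ p" using \<epsilon> by (intro power_mono) auto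
    have err: "norm (X \<omega> t - v t) \<le> \<epsilon> * (A * root ?q (V \<omega>))"
      if \<omega>: "\<omega> \<in> space M" and t: "0 \<le> t" "t \<le> T0" for \<omega> t
    proof -
      let ?V = "root ?q (V \<omega>)"
      have V1: "1 \<le> ?V" using V(2)[of \<omega>] q by simp
      have "norm (X \<omega> t - v t) \<le> \<epsilon> * ((CARD('d) * ?V + 2 * L * B * T0) * exp (L * T0) + 2 * B)"
      proof (rule error_le_centered_sums[OF \<omega> \<epsilon>(1) X[OF \<omega>] v _ t])
        fix k assume "\<epsilon> * real k \<le> T0"
        then have "real k \<le> T0 / \<epsilon>" using \<epsilon> by (simp add: field_simps)
        then have "k \<le> n" unfolding n_def by (metis le_nat_floor)
        then show "norm (\<Sum>j<k. centered_field M F (v (\<epsilon> * real j)) ((T ^^ j) \<omega>)) \<le> CARD('d) * ?V"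
          using r by (intro V(4)) simp
      qed
      also have "\<dots> \<le> \<epsilon> * ((CARD('d) * ?V + 2 * L * B * T0 * ?V) * exp (L * T0) + 2 * B * ?V)"
        using \<epsilon> mult_left_mono[OF V1, of "2 * L * B * T0"] mult_left_mono[OF V1, of "2 * B"] L_nonneg B_nonneg T0
        by (intro mult_left_mono mult_right_mono add_mono) auto
      also have "\<dots> = \<epsilon> * (A * ?V)" by (simp add: A_def algebra_simps)
      finally show ?thesis .
    qed
    have "Lq_norm ?q M (\<lambda>\<omega>. SUP t\<in>{0..T0}. ennreal (infnorm (X \<omega> t - v t)))
        \<le> ennreal (root ?q ((A ^ ?q * (1 + D * Q ^ p)) * \<epsilon> ^ p))"
    proof (rule Lq_norm_le_root[where V="\<lambda>\<omega>. (\<epsilon> * A) ^ ?q * V \<omega>"])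
      show "0 \<le> (\<epsilon> * A) ^ ?q * V \<omega>" for \<omega> using \<epsilon> A0 V(2)[of \<omega>] by simp
      show "(SUP t\<in>{0..T0}. ennreal (infnorm (X \<omega> t - v t))) \<le> ennreal (root ?q ((\<epsilon> * A) ^ ?q * V \<omega>))"
        if "\<omega> \<in> space M" for \<omega>
      proof -
        have "0 \<le> \<epsilon> * A" using \<epsilon> A0 by simp
        then have "root ?q ((\<epsilon> * A) ^ ?q * V \<omega>) = \<epsilon> * (A * root ?q (V \<omega>))"
          using q by (simp only: real_root_mult real_root_power_cancel mult.assoc)
        then show ?thesis
          using err[OF that] by (auto intro!: SUP_least ennreal_leI intro: order_trans[OF infnorm_le_norm])
      qed
      have "(LINT \<omega>|M. (\<epsilon> * A) ^ ?q * V \<omega>) \<le> (\<epsilon> * A) ^ ?q * (1 + D * (2 ^ r) ^ p)"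
        using V(3) \<epsilon> A0 by (simp add: mult_left_mono)
      also have "\<dots> = A ^ ?q * \<epsilon> ^ p * (\<epsilon> ^ p + D * (\<epsilon> * 2 ^ r) ^ p)"
      proof -
        have "(\<epsilon> * A) ^ ?q = A ^ ?q * \<epsilon> ^ p * \<epsilon> ^ p"
          unfolding power_mult_distrib mult_2 power_add by simp
        then show ?thesis by (simp only: power_mult_distrib distrib_left mult_ac mult_1_right)
      qed
      also have "\<dots> \<le> A ^ ?q * \<epsilon> ^ p * (1 + D * Q ^ p)"
        using \<epsilon> A0 D Qp by (intro mult_left_mono add_mono power_le_one) auto
      finally show "(LINT \<omega>|M. (\<epsilon> * A) ^ ?q * V \<omega>) \<le> (A ^ ?q * (1 + D * Q ^ p)) * \<epsilon> ^ p"
        by (simp add: mult_ac)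
    qed (use q V(1) in auto)
    also have "root ?q ((A ^ ?q * (1 + D * Q ^ p)) * \<epsilon> ^ p) = root ?q (A ^ ?q * (1 + D * Q ^ p)) * sqrt \<epsilon>"
    proof -
      have "\<epsilon> ^ p = sqrt \<epsilon> ^ ?q" using \<epsilon> by (simp add: power_mult)
      then have "root ?q (\<epsilon> ^ p) = sqrt \<epsilon>" using real_root_power_cancel[OF q(1), of "sqrt \<epsilon>"] \<epsilon> by simp
      then show ?thesis by (simp only: real_root_mult)
    qed
    finally show "Lq_norm ?q M (\<lambda>\<omega>. SUP t\<in>{0..T0}. ennreal (infnorm (X \<omega> t - v t)))
        \<le> ennreal (root ?q (A ^ ?q * (1 + D * Q ^ p)) * sqrt \<epsilon>)" .
  qed
qed

end

theorem theoremA1p5: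
  fixes M :: "'a measure" and T :: "'a \<Rightarrow> 'a"
    and F :: "real^'d \<Rightarrow> 'a \<Rightarrow> real^'d"
    and X :: "real \<Rightarrow> real^'d \<Rightarrow> 'a \<Rightarrow> real \<Rightarrow> real^'d"
    and w :: "real^'d \<Rightarrow> real \<Rightarrow> real^'d"
    and T0 :: real and p :: nat
  assumes "invertible_prob_system M T"
    and "(\<lambda>(x, \<omega>). F x \<omega>) \<in> borel_measurable (borel \<Otimes>\<^sub>M M)"
    and "bounded ((\<lambda>(x, \<omega>). F x \<omega>) ` (UNIV \<times> space M))"
    and "\<exists>L. \<forall>\<omega>\<in>space M. L-lipschitz_on UNIV (\<lambda>x. F x \<omega>)"
    and "\<And>\<epsilon> x \<omega>. \<epsilon> > 0 \<Longrightarrow> \<omega> \<in> space M \<Longrightarrow> perturbed_solution T F \<epsilon> x \<omega> (X \<epsilon> x \<omega>)"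
    and "\<And>x. averaged_solution M F x (w x)"
    and "T0 > 0" and "p \<ge> 2"
    and "(\<lambda>N. moment_sum M T (centered_coordinates M F) (2 * p) N) \<in> O(\<lambda>N. real N ^ p)"
  shows "\<exists>C. \<forall>\<^sub>F \<epsilon> in at_right 0.
    (SUP x. Lq_norm (2 * p) M (\<lambda>\<omega>. SUP t\<in>{0..T0}. ennreal (infnorm (X \<epsilon> x \<omega> t - w x t))))
      \<le> ennreal (C * sqrt \<epsilon>)"
proof -
  interpret invertible_prob_system M T by (rule assms(1))
  obtain B where B: "\<And>x \<omega>. \<omega> \<in> space M \<Longrightarrow> norm (F x \<omega>) \<le> B"
    using assms(3) unfolding bounded_iff by auto
  obtain L where L: "\<And>\<omega>. \<omega> \<in> space M \<Longrightarrow> L-lipschitz_on UNIV (\<lambda>x. F x \<omega>)"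
    using assms(4) by auto
  interpret bounded_lipschitz_field M T F B L
  proof
    show "F x \<in> borel_measurable M" for x
      using measurable_Pair2[OF assms(2), of x] by simp
  qed (use B L in auto)
  obtain K where K: "0 \<le> K" "\<And>N. moment_sum M T (centered_coordinates M F) (2 * p) N \<le> K * real N ^ p"
    using moment_sum_bound[OF assms(9)] assms(8) by auto
  obtain c where c:
    "\<forall>\<epsilon> x X v. 0 < \<epsilon> \<and> \<epsilon> \<le> 1 \<and> (\<forall>\<omega>\<in>space M. perturbed_solution T F \<epsilon> x \<omega> (X \<omega>)) \<and>
      averaged_solution M F x v \<longrightarrow>
    Lq_norm (2 * p) M (\<lambda>\<omega>. SUP t\<in>{0..T0}. ennreal (infnorm (X \<omega> t - v t))) \<le> ennreal (c * sqrt \<epsilon>)"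
    using Lq_norm_error_le[OF assms(8) less_imp_le[OF assms(7)] K] by (elim exE)
  have "(SUP x. Lq_norm (2 * p) M (\<lambda>\<omega>. SUP t\<in>{0..T0}. ennreal (infnorm (X \<epsilon> x \<omega> t - w x t))))
      \<le> ennreal (c * sqrt \<epsilon>)" if "0 < \<epsilon>" "\<epsilon> < 1" for \<epsilon>
    using that assms(5,6) by (intro SUP_least c[rule_format]) auto
  then show ?thesis
    by (intro exI[of _ c]) (auto simp: eventually_at_right_field intro!: exI[of _ 1])
qed

end
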